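(* Let $G=(V,E)$ be a finite connected weighted graph with $|V|\ge2$ and symmetric real weights $w_{uv}$ (possibly negative; $w_{uv}=0$ if $\{u,v\}\notin E$). Let $H=L+W$, where $L$ is either the combinatorial or the normalized Laplacian of $G$ and $W$ is a real diagonal matrix indexed by $V$, and suppose that the ground-state $\phi$ of $H$ satisfies $\phi\ge0$. Let $\gamma=\lambda_1-\lambda_0$ be the difference of the two lowest eigenvalues of $H$ and let $h$ be the weighted Cheeger constant corresponding to $\phi$. Then $$\gamma\le 2h .$$
   Context: The degree of $u$ is $d_u=\sum_v w_{uv}$. The combinatorial Laplacian has entries $L(u,u)=d_u$, $L(u,v)=-w_{uv}$ ($u\ne v$); the normalized Laplacian (for which all $d_u>0$) has entries $1$ on the diagonal and $-w_{uv}/\sqrt{d_ud_v}$ off the diagonal. Put $q_u=1$ in the combinatorial case and $q_u=d_u$ in the normalized case. The ground-state is taken in the form $\phi$, not identically zero, solving $(\lambda_0-W_u)q_u\phi(u)=\sum_v w_{uv}[\phi(u)-\phi(v)]$ for all $u$, i.e. $\phi$ is an eigenvector of $H$ for $\lambda_0$ in the combinatorial case and $\mathrm{diag}(d_u)^{-1/2}$ times such an eigenvector in the normalized case. For $S\subset V$ with complement $\overline S$, let $|\partial S|=\sum_{u\in S,v\in\overline S}w_{uv}\phi(u)\phi(v)$ and $\mathrm{vol}(S)=\sum_{u\in S}q_u\phi^2(u)$. The weighted Cheeger constant is $$h=\min_{S}\frac{|\partial S|}{\min\{\mathrm{vol}(S),\mathrm{vol}(\overline S)\}},$$ the minimum being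 over $S\subset V$ with $\mathrm{vol}(S)>0$ and $\mathrm{vol}(\overline S)>0$. *)

theory Defs
  imports "HOL-Analysis.Analysis" "HOL-Library.Multiset"
begin

text \<open>
  A graph on the finite vertex type \<open>'v\<close> is given by its edge set \<open>E\<close>; edges are two-element
  sets, so there are no loops.  The weights may have either sign, and zero-weight edges are
  not excluded.
\<close>

definition connected_graph :: "'v set set \<Rightarrow> bool" where
  "connected_graph E \<longleftrightarrow> (\<forall>u v. (u, v) \<in> {(x, y). {x, y} \<in> E}\<^sup>*)"

definition connected_weighted_graph :: "'v::finite set set \<Rightarrow> ('v \<Rightarrow> 'v \<Rightarrow> real) \<Rightarrow> bool" where
  "connected_weighted_graph E w \<longleftrightarrow>
     (\<forall>e\<in>E. card e = 2) \<and> connected_graph E \<and>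
     (\<forall>u v. w u v = w v u) \<and> (\<forall>u v. {u, v} \<notin> E \<longrightarrow> w u v = 0)"

definition wdegree :: "('v::finite \<Rightarrow> 'v \<Rightarrow> real) \<Rightarrow> 'v \<Rightarrow> real" where
  "wdegree w u = (\<Sum>v\<in>UNIV. w u v)"

datatype laplacian_kind = Combinatorial | Normalized

definition laplacian :: "laplacian_kind \<Rightarrow> ('v::finite \<Rightarrow> 'v \<Rightarrow> real) \<Rightarrow> real^'v^'v" where
  "laplacian K w = (case K of
      Combinatorial \<Rightarrow> (\<chi> u v. if u = v then wdegree w u else - w u v)
    | Normalized \<Rightarrow> (\<chi> u v. if u = v then 1 else - w u v / sqrt (wdegree w u * wdegree w v)))"

definition qweight :: "laplacian_kind \<Rightarrow> ('v::finite \<Rightarrow> 'v \<Rightarrow> real) \<Rightarrow> 'v \<Rightarrow> real" where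
  "qweight K w u = (case K of Combinatorial \<Rightarrow> 1 | Normalized \<Rightarrow> wdegree w u)"

definition diagonal_mat :: "real^'v^'v \<Rightarrow> bool" where
  "diagonal_mat W \<longleftrightarrow> (\<forall>u v. u \<noteq> v \<longrightarrow> W $ u $ v = 0)"

definition eigenspace :: "real^'v^'v \<Rightarrow> real \<Rightarrow> (real^'v) set" where
  "eigenspace A c = {x. A *v x = c *\<^sub>R x}"

definition spectrum :: "real^'v^'v \<Rightarrow> real set" where
  "spectrum A = {c. \<exists>x. x \<noteq> 0 \<and> A *v x = c *\<^sub>R x}"

text \<open>
  The real eigenvalues in increasing order, each repeated as often as the dimension of its
  eigenspace.  For a symmetric matrix this is the full list of eigenvalues
  \<open>\<lambda>\<^sub>0 \<le> \<lambda>\<^sub>1 \<le> \<dots>\<close> with multiplicity.  The sum ranges over a finite set, see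
  \<open>finite_spectrum\<close> below.
\<close>

definition eigenvalue_mset :: "real^'v^'v \<Rightarrow> real multiset" where
  "eigenvalue_mset A = (\<Sum>c\<in>spectrum A. replicate_mset (dim (eigenspace A c)) c)"

definition nth_eigenvalue :: "real^'v^'v \<Rightarrow> nat \<Rightarrow> real" where
  "nth_eigenvalue A k = sorted_list_of_multiset (eigenvalue_mset A) ! k"

definition spectral_gap :: "real^'v^'v \<Rightarrow> real" where
  "spectral_gap A = nth_eigenvalue A 1 - nth_eigenvalue A 0"

definition ground_state ::
    "laplacian_kind \<Rightarrow> ('v::finite \<Rightarrow> 'v \<Rightarrow> real) \<Rightarrow> real^'v^'v \<Rightarrow> real^'v \<Rightarrow> bool" where
  "ground_state K w W \<phi> \<longleftrightarrow> \<phi> \<noteq> 0 \<and>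
     (\<forall>u. (nth_eigenvalue (laplacian K w + W) 0 - W $ u $ u) * qweight K w u * \<phi> $ u
            = (\<Sum>v\<in>UNIV. w u v * (\<phi> $ u - \<phi> $ v)))"

definition boundary_weight :: "('v::finite \<Rightarrow> 'v \<Rightarrow> real) \<Rightarrow> real^'v \<Rightarrow> 'v set \<Rightarrow> real" where
  "boundary_weight w \<phi> S = (\<Sum>u\<in>S. \<Sum>v\<in>- S. w u v * \<phi> $ u * \<phi> $ v)"

definition vol ::
    "laplacian_kind \<Rightarrow> ('v::finite \<Rightarrow> 'v \<Rightarrow> real) \<Rightarrow> real^'v \<Rightarrow> 'v set \<Rightarrow> real" where
  "vol K w \<phi> S = (\<Sum>u\<in>S. qweight K w u * (\<phi> $ u)\<^sup>2)"

definition admissible_cuts ::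
    "laplacian_kind \<Rightarrow> ('v::finite \<Rightarrow> 'v \<Rightarrow> real) \<Rightarrow> real^'v \<Rightarrow> 'v set set" where
  "admissible_cuts K w \<phi> = {S. vol K w \<phi> S > 0 \<and> vol K w \<phi> (- S) > 0}"

definition cheeger_ratio ::
    "laplacian_kind \<Rightarrow> ('v::finite \<Rightarrow> 'v \<Rightarrow> real) \<Rightarrow> real^'v \<Rightarrow> 'v set \<Rightarrow> real" where
  "cheeger_ratio K w \<phi> S = boundary_weight w \<phi> S / min (vol K w \<phi> S) (vol K w \<phi> (- S))"

text \<open>
  Extended reals only serve the degenerate case without admissible sets (\<open>\<phi>\<close> supported on a
  single vertex all of whose edges have weight zero), where the constant is \<open>\<infinity>\<close>.
  Otherwise it is the real minimum, see \<open>cheeger_constant_eq_Min\<close> below.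
\<close>

definition cheeger_constant ::
    "laplacian_kind \<Rightarrow> ('v::finite \<Rightarrow> 'v \<Rightarrow> real) \<Rightarrow> real^'v \<Rightarrow> ereal" where
  "cheeger_constant K w \<phi> = (INF S\<in>admissible_cuts K w \<phi>. ereal (cheeger_ratio K w \<phi> S))"

lemma cheeger_constant_eq_Min:
  assumes "admissible_cuts K w \<phi> \<noteq> {}"
  shows "cheeger_constant K w \<phi> = ereal (Min (cheeger_ratio K w \<phi> ` admissible_cuts K w \<phi>))"
proof -
  let ?R = "cheeger_ratio K w \<phi> ` admissible_cuts K w \<phi>"
  have R: "finite ?R" "?R \<noteq> {}" using assms by auto
  have "(INF S\<in>admissible_cuts K w \<phi>. ereal (cheeger_ratio K w \<phi> S)) = ereal (Min ?R)"
  proof (rule antisym)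
    obtain S where "S \<in> admissible_cuts K w \<phi>" "Min ?R = cheeger_ratio K w \<phi> S"
      using Min_in[OF R] by auto
    then show "(INF S\<in>admissible_cuts K w \<phi>. ereal (cheeger_ratio K w \<phi> S)) \<le> ereal (Min ?R)"
      by (auto intro: INF_lower)
    show "ereal (Min ?R) \<le> (INF S\<in>admissible_cuts K w \<phi>. ereal (cheeger_ratio K w \<phi> S))"
      using R by (intro INF_greatest) auto
  qed
  then show ?thesis by (simp add: cheeger_constant_def)
qed

lemma finite_spectrum: "finite (spectrum (A :: real^'v^'v))"
proof -
  define f where "f c = (SOME x. x \<noteq> 0 \<and> A *v x = c *\<^sub>R x)" for c
  have f: "f c \<noteq> 0" "A *v f c = c *\<^sub>R f c" if "c \<in> spectrum A" for c
    using someI_ex[of "\<lambda>x. x \<noteq> 0 \<and> A *v x = c *\<^sub>R x"] that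
    by (auto simp: f_def spectrum_def)
  have inj: "inj_on f (spectrum A)"
    by (rule inj_onI) (metis f scaleR_cancel_right)
  have small: "independent (f ` C)" if "finite C" "C \<subseteq> spectrum A" for C
    using that
  proof (induction C rule: finite_induct)
    case (insert c C)
    have "f c \<notin> span (f ` C)"
    proof
      assume "f c \<in> span (f ` C)"
      then obtain a where a: "f c = (\<Sum>x\<in>f ` C. a x *\<^sub>R x)"
        using insert.hyps by (auto simp: span_finite)
      have injC: "inj_on f C" using inj insert.prems by (meson inj_on_subset subset_insertI subset_trans)
      have a': "f c = (\<Sum>d\<in>C. a (f d) *\<^sub>R f d)"
        using a injC by (simp add: sum.reindex)
      have "A *v f c = (\<Sum>d\<in>C. a (f d) *\<^sub>R (d *\<^sub>R f d))"
      proof -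
        have "A *v f c = (\<Sum>d\<in>C. A *v (a (f d) *\<^sub>R f d))"
          by (subst a') (simp add: linear_sum[OF matrix_vector_mul_linear])
        also have "\<dots> = (\<Sum>d\<in>C. a (f d) *\<^sub>R (d *\<^sub>R f d))"
          using insert.prems by (intro sum.cong) (auto simp: f matrix_vector_mult_scaleR)
        finally show ?thesis .
      qed
      moreover have "A *v f c = (\<Sum>d\<in>C. a (f d) *\<^sub>R (c *\<^sub>R f d))"
      proof -
        have "A *v f c = c *\<^sub>R f c" using insert.prems by (simp add: f)
        also have "\<dots> = (\<Sum>d\<in>C. a (f d) *\<^sub>R (c *\<^sub>R f d))"
          by (subst a') (simp add: scaleR_sum_right mult.commute)
        finally show ?thesis .
      qed
      ultimately have "(\<Sum>d\<in>C. (a (f d) * (d - c)) *\<^sub>R f d) = 0"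
        by (simp add: sum_subtractf algebra_simps)
      then have z: "(\<Sum>x\<in>f ` C. (a x * (inv_into C f x - c)) *\<^sub>R x) = 0"
        using injC by (simp add: sum.reindex)
      have "independent (f ` C)" using insert by simp
      then have "\<forall>x\<in>f ` C. a x * (inv_into C f x - c) = 0"
        using z insert.hyps(1)
          independent_explicit_finite_subsets[THEN iffD1, rule_format,
            of "f ` C" "f ` C" "\<lambda>x. a x * (inv_into C f x - c)"]
        by auto
      then have "\<forall>d\<in>C. a (f d) = 0"
        using injC insert.hyps(2) by (auto simp del: mult_eq_0_iff simp: mult_eq_0_iff[where 'a=real])
      then have "f c = 0" using a' by simp
      then show False using f insert.prems by simp
    qed
    then show ?case using insert by (simp add: independent_insertI)
  qed (simp add: independent_empty)
  show ?thesis
  proof (rule ccontr)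
    assume "infinite (spectrum A)"
    then obtain C where C: "C \<subseteq> spectrum A" "finite C" "card C = Suc (DIM(real^'v))"
      using infinite_arbitrarily_large by blast
    then have "card (f ` C) = Suc (DIM(real^'v))"
      using inj by (metis card_image inj_on_subset)
    moreover have "card (f ` C) \<le> DIM(real^'v)"
      using small[OF C(2,1)] independent_bound by blast
    ultimately show False by simp
  qed
qed

lemma ground_state_combinatorial:
  assumes "connected_weighted_graph E w" "diagonal_mat W"
  defines "H \<equiv> laplacian Combinatorial w + W"
  shows "ground_state Combinatorial w W \<phi> \<longleftrightarrow> \<phi> \<noteq> 0 \<and> H *v \<phi> = nth_eigenvalue H 0 *\<^sub>R \<phi>"
proof -
  have loop: "w u u = 0" for u
    using assms(1) by (force simp: connected_weighted_graph_def)
  have W: "(W *v \<phi>) $ u = W $ u $ u * \<phi> $ u" for u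
  proof -
    have "(W *v \<phi>) $ u = (\<Sum>v\<in>UNIV. if v = u then W $ u $ u * \<phi> $ u else 0)"
      unfolding matrix_vector_mult_def vec_lambda_beta
      using assms(2) by (intro sum.cong refl) (auto simp: diagonal_mat_def)
    then show ?thesis by simp
  qed
  have L: "(laplacian Combinatorial w *v \<phi>) $ u = (\<Sum>v\<in>UNIV. w u v * (\<phi> $ u - \<phi> $ v))" for u
  proof -
    have "(laplacian Combinatorial w *v \<phi>) $ u
        = (\<Sum>v\<in>UNIV. (if v = u then wdegree w u * \<phi> $ u else 0) - w u v * \<phi> $ v)"
      using loop by (auto simp: laplacian_def matrix_vector_mult_def intro!: sum.cong)
    then show ?thesis
      by (simp add: sum_subtractf wdegree_def sum_distrib_right right_diff_distrib)
  qed
  have "H *v \<phi> = nth_eigenvalue H 0 *\<^sub>R \<phi> \<longleftrightarrow>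
      (\<forall>u. (nth_eigenvalue H 0 - W $ u $ u) * \<phi> $ u = (\<Sum>v\<in>UNIV. w u v * (\<phi> $ u - \<phi> $ v)))"
    by (auto simp: vec_eq_iff H_def matrix_vector_mult_add_rdistrib W L algebra_simps)
  then show ?thesis
    by (auto simp: ground_state_def qweight_def H_def)
qed

lemma ground_state_normalized:
  assumes "connected_weighted_graph E w" "diagonal_mat W" "\<forall>u. wdegree w u > 0"
  defines "H \<equiv> laplacian Normalized w + W"
  defines "g \<equiv> \<lambda>\<phi>. \<chi> u. sqrt (wdegree w u) * \<phi> $ u"
  shows "ground_state Normalized w W \<phi> \<longleftrightarrow> g \<phi> \<noteq> 0 \<and> H *v g \<phi> = nth_eigenvalue H 0 *\<^sub>R g \<phi>"
proof -
  let ?d = "wdegree w"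
  have loop: "w u u = 0" for u
    using assms(1) by (force simp: connected_weighted_graph_def)
  have d: "?d u > 0" "sqrt (?d u) > 0" "sqrt (?d u) * sqrt (?d u) = ?d u" "?d u \<noteq> 0" for u
    using assms(3) by (auto simp: less_imp_le less_imp_neq[symmetric])
  have W: "(W *v g \<phi>) $ u = W $ u $ u * sqrt (?d u) * \<phi> $ u" for u
  proof -
    have "(W *v g \<phi>) $ u = (\<Sum>v\<in>UNIV. if v = u then W $ u $ u * sqrt (?d u) * \<phi> $ u else 0)"
      unfolding g_def matrix_vector_mult_def vec_lambda_beta
      using assms(2) by (intro sum.cong refl) (auto simp: diagonal_mat_def)
    then show ?thesis by simp
  qed
  have L: "sqrt (?d u) * (laplacian Normalized w *v g \<phi>) $ u
      = (\<Sum>v\<in>UNIV. w u v * (\<phi> $ u - \<phi> $ v))" for u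
  proof -
    have "sqrt (?d u) * (laplacian Normalized w *v g \<phi>) $ u
        = (\<Sum>v\<in>UNIV. (if v = u then ?d u * \<phi> $ u else 0) - w u v * \<phi> $ v)"
      unfolding matrix_vector_mult_def laplacian_def g_def
      using loop d(3,4) by (auto simp: sum_distrib_left real_sqrt_mult field_simps intro!: sum.cong)
    then show ?thesis
      by (simp add: sum_subtractf wdegree_def sum_distrib_right right_diff_distrib)
  qed
  have "(H *v g \<phi>) $ u = (nth_eigenvalue H 0 *\<^sub>R g \<phi>) $ u \<longleftrightarrow>
      (nth_eigenvalue H 0 - W $ u $ u) * ?d u * \<phi> $ u = (\<Sum>v\<in>UNIV. w u v * (\<phi> $ u - \<phi> $ v))" for u
  proof -
    have "(H *v g \<phi>) $ u = (nth_eigenvalue H 0 *\<^sub>R g \<phi>) $ u \<longleftrightarrow>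
        sqrt (?d u) * (H *v g \<phi>) $ u = sqrt (?d u) * (nth_eigenvalue H 0 *\<^sub>R g \<phi>) $ u"
      using d(2)[of u] by simp
    also have "sqrt (?d u) * (H *v g \<phi>) $ u =
        (\<Sum>v\<in>UNIV. w u v * (\<phi> $ u - \<phi> $ v)) + sqrt (?d u) * (W $ u $ u * sqrt (?d u) * \<phi> $ u)"
      by (simp add: H_def matrix_vector_mult_add_rdistrib distrib_left W flip: L)
    also have "sqrt (?d u) * (W $ u $ u * sqrt (?d u) * \<phi> $ u)
        = W $ u $ u * (sqrt (?d u) * sqrt (?d u)) * \<phi> $ u"
      by (simp only: mult_ac)
    also have "sqrt (?d u) * (nth_eigenvalue H 0 *\<^sub>R g \<phi>) $ u
        = nth_eigenvalue H 0 * (sqrt (?d u) * sqrt (?d u)) * \<phi> $ u"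
      by (simp add: g_def mult_ac)
    finally show ?thesis unfolding d(3) by (auto simp: left_diff_distrib)
  qed
  moreover have "g \<phi> \<noteq> 0 \<longleftrightarrow> \<phi> \<noteq> 0"
    using d(2) by (auto simp: g_def vec_eq_iff less_imp_neq[symmetric])
  ultimately show ?thesis
    by (auto simp: ground_state_def qweight_def H_def[symmetric] vec_eq_iff[of "H *v g \<phi>"])
qed

end

theory Submission
  imports Defs
begin

text \<open>
  The bound comes from one test vector in a Rayleigh quotient. Write \<open>H = laplacian K w + W\<close> and
  let \<open>p\<close> have entries \<open>sqrt q\<^sub>u * \<phi> u\<close>; this is the eigenvector of \<open>H\<close> for the lowest eigenvalue
  \<open>\<lambda>\<^sub>0\<close> that corresponds to \<open>\<phi>\<close>, in the combinatorial and in the normalized case alike.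

  Substituting \<open>x u = sqrt q\<^sub>u * f u * \<phi> u\<close> removes both the potential \<open>W\<close> and \<open>\<lambda>\<^sub>0\<close> from the form
  \<open>x \<bullet> H x - \<lambda>\<^sub>0 (x \<bullet> x)\<close>: what is left is the Dirichlet form of \<open>f\<close> with edge weights
  \<open>w u v * \<phi> u * \<phi> v\<close> (\<open>ground_state_transform\<close>). These are exactly the weights that define
  \<open>boundary_weight\<close>. Given a cut \<open>S\<close> with volumes \<open>a = vol S\<close> and \<open>b = vol (- S)\<close>, let \<open>f\<close> be \<open>b\<close> on \<open>S\<close>
  and \<open>- a\<close> on its complement. Then \<open>x\<close> is orthogonal to \<open>p\<close>, \<open>x \<bullet> x = a * b * (a + b)\<close>, and the
  Dirichlet form is \<open>(a + b)\<^sup>2\<close> times the boundary weight \<open>d\<close> of \<open>S\<close>, because only edges across the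
  cut contribute.

  On the orthogonal complement of \<open>p\<close> the Rayleigh quotient of \<open>H\<close> is at least the second eigenvalue
  (\<open>spectral_gap_le_form\<close>), so the gap is at most \<open>d / a + d / b\<close>. This is at most
  \<open>2 * d / min a b\<close> provided \<open>d \<ge> 0\<close>. With weights of both signs this sign is not visible from the
  definition of \<open>d\<close>; it follows because the form \<open>x \<bullet> H x - \<lambda>\<^sub>0 (x \<bullet> x)\<close> is nonnegative,
  \<open>\<lambda>\<^sub>0\<close> being the lowest eigenvalue.
\<close>

section \<open>The spectrum of a symmetric matrix from below\<close>

lemma symmetric_matrix_inner_commute:
  fixes A :: "real^'n^'n"
  assumes "transpose A = A"
  shows "(A *v x) \<bullet> y = x \<bullet> (A *v y)"
  by (metis assms dot_lmul_matrix transpose_matrix_vector)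

text \<open>
  A minimizer of the Rayleigh quotient over the unit vectors of an invariant subspace exists by
  compactness and is an eigenvector. This replaces a full orthonormal eigenbasis: a lower bound on
  the form over the complement of one eigenvector is all that the second eigenvalue requires.
\<close>

lemma symmetric_matrix_minimizer_is_eigenvector:
  fixes A :: "real^'n^'n"
  assumes sym: "transpose A = A" and V: "subspace V"
    and inv: "\<And>y. y \<in> V \<Longrightarrow> A *v y \<in> V"
    and "z \<in> V" "z \<noteq> 0"
  obtains x \<mu> where "x \<in> V" "x \<noteq> 0" "A *v x = \<mu> *\<^sub>R x"
    "\<And>y. y \<in> V \<Longrightarrow> \<mu> * (y \<bullet> y) \<le> y \<bullet> (A *v y)"
proof -
  let ?K = "sphere 0 1 \<inter> V"
  have "compact ?K"
    by (intro compact_Int_closed closed_subspace V) simp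
  moreover have "z /\<^sub>R norm z \<in> ?K"
    using assms by (simp add: subspace_scale)
  moreover have "continuous_on ?K (\<lambda>y. y \<bullet> (A *v y))"
    by (intro continuous_intros)
  ultimately obtain x where x: "x \<in> ?K" and min: "\<And>y. y \<in> ?K \<Longrightarrow> x \<bullet> (A *v x) \<le> y \<bullet> (A *v y)"
    using continuous_attains_inf[of ?K "\<lambda>y. y \<bullet> (A *v y)"] by blast
  define \<mu> where "\<mu> = x \<bullet> (A *v x)"
  have xV: "x \<in> V" and xx: "x \<bullet> x = 1"
    using x by (auto simp: norm_eq_1)
  have ray: "\<mu> * (y \<bullet> y) \<le> y \<bullet> (A *v y)" if "y \<in> V" for y
  proof (cases "y = 0")
    case False
    then have "y /\<^sub>R norm y \<in> ?K"
      using that V by (simp add: subspace_scale)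
    then have "\<mu> \<le> (y \<bullet> (A *v y)) / (norm y)\<^sup>2"
      unfolding \<mu>_def using min by (fastforce simp: matrix_vector_mult_scaleR power2_eq_square divide_simps)
    then show ?thesis
      using False by (simp add: field_simps power2_norm_eq_inner)
  qed simp
  define r where "r = A *v x - \<mu> *\<^sub>R x"
  have rV: "r \<in> V"
    unfolding r_def using xV inv V by (simp add: subspace_diff subspace_scale)
  define c where "c = r \<bullet> (A *v r) - \<mu> * (r \<bullet> r)"
  \<comment> \<open>Perturbing the minimizer to \<open>x + t *\<^sub>R r\<close> changes the nonnegative form \<open>y \<bullet> (A *v y) - \<mu> * (y \<bullet> y)\<close> from
     \<open>0\<close> to \<open>2 * t * (r \<bullet> r) + t\<^sup>2 * c\<close>, which would be negative for small negative \<open>t\<close> if \<open>r \<noteq> 0\<close>.\<close>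
  have quad: "0 \<le> 2 * t * (r \<bullet> r) + t\<^sup>2 * c" for t
  proof -
    let ?y = "x + t *\<^sub>R r"
    have "?y \<in> V" using xV rV V by (simp add: subspace_add subspace_scale)
    from ray[OF this] have "0 \<le> ?y \<bullet> (A *v ?y) - \<mu> * (?y \<bullet> ?y)" by simp
    also have "\<dots> = (x \<bullet> (A *v x) - \<mu> * (x \<bullet> x)) + t * (x \<bullet> (A *v r) + r \<bullet> (A *v x) - 2 * \<mu> * (r \<bullet> x)) + t\<^sup>2 * c"
      by (simp add: c_def matrix_vector_right_distrib matrix_vector_mult_scaleR
          inner_add_left inner_add_right inner_commute[of x r] power2_eq_square algebra_simps)
    also have "x \<bullet> (A *v r) = r \<bullet> (A *v x)"
      using symmetric_matrix_inner_commute[OF sym, of x r] by (simp add: inner_commute)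
    also have "r \<bullet> (A *v x) + r \<bullet> (A *v x) - 2 * \<mu> * (r \<bullet> x) = 2 * (r \<bullet> r)"
      by (subst (4) r_def) (simp add: inner_diff_right)
    finally show ?thesis by (simp add: \<mu>_def xx algebra_simps)
  qed
  have c: "0 \<le> c" using ray[OF rV] by (simp add: c_def)
  have "r \<bullet> r = 0"
  proof (rule ccontr)
    assume "r \<bullet> r \<noteq> 0"
    then have pos: "0 < (r \<bullet> r)\<^sup>2 * (c + 2)" using c by simp
    have "2 * (- (r \<bullet> r) / (c + 1)) * (r \<bullet> r) + (- (r \<bullet> r) / (c + 1))\<^sup>2 * c
        = - ((r \<bullet> r)\<^sup>2 * (c + 2)) / (c + 1)\<^sup>2"
      using c by (simp add: divide_simps power2_eq_square) (simp add: algebra_simps)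
    moreover have "\<dots> < 0" using pos c by (intro divide_neg_pos) auto
    ultimately show False using quad[of "- (r \<bullet> r) / (c + 1)"] by linarith
  qed
  then have "A *v x = \<mu> *\<^sub>R x" by (simp add: r_def)
  moreover have "x \<noteq> 0" using xx by auto
  ultimately show ?thesis using that xV ray by blast
qed

text \<open>
  Bounds a single entry of the sorted eigenvalue list by counting, so that eigenvalues are
  estimated without determining the list.
\<close>

lemma sorted_list_of_multiset_nth_le:
  fixes M :: "'a::linorder multiset"
  assumes "k < size (filter_mset (\<lambda>a. a \<le> b) M)"
  shows "sorted_list_of_multiset M ! k \<le> b"
proof (rule ccontr)
  let ?xs = "sorted_list_of_multiset M"
  assume "\<not> ?xs ! k \<le> b"
  then have gt: "b < ?xs ! k" by simp
  have "filter (\<lambda>a. a \<le> b) (drop k ?xs) = []"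
  proof -
    have "b < ?xs ! i" if "k \<le> i" "i < length ?xs" for i
      using gt sorted_nth_mono[OF sorted_sorted_list_of_multiset that] by simp
    then have "b < a" if "a \<in> set (drop k ?xs)" for a
      using that by (auto simp: in_set_conv_nth)
    then show ?thesis by (auto simp: filter_empty_conv not_le)
  qed
  then have "filter (\<lambda>a. a \<le> b) ?xs = filter (\<lambda>a. a \<le> b) (take k ?xs)"
    by (metis append_Nil2 append_take_drop_id filter_append)
  then have "length (filter (\<lambda>a. a \<le> b) ?xs) \<le> k"
    by (metis length_filter_le length_take min.bounded_iff)
  moreover have "length (filter (\<lambda>a. a \<le> b) ?xs) = size (filter_mset (\<lambda>a. a \<le> b) M)"
    by (metis mset_filter mset_sorted_list_of_multiset size_mset)
  ultimately show False using assms by simp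
qed

lemma count_eigenvalue_mset:
  assumes "c \<in> spectrum A"
  shows "count (eigenvalue_mset A) c = dim (eigenspace A c)"
  using assms finite_spectrum[of A]
  by (simp add: eigenvalue_mset_def count_sum)

lemma nth_eigenvalue_0_le:
  assumes "A *v x = c *\<^sub>R x" "x \<noteq> 0"
  shows "nth_eigenvalue A 0 \<le> c"
proof -
  have "1 \<le> count (eigenvalue_mset A) c"
    using assms independent_card_le_dim[of "{x}" "eigenspace A c"]
    by (subst count_eigenvalue_mset) (auto simp: spectrum_def eigenspace_def)
  then have "0 < size (filter_mset (\<lambda>a. a \<le> c) (eigenvalue_mset A))"
    by (metis (mono_tags, lifting) count_filter_mset dual_order.refl less_le_trans
        count_greater_zero_iff gr0I not_one_le_zero size_eq_0_iff_empty count_empty)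
  then show ?thesis
    unfolding nth_eigenvalue_def by (rule sorted_list_of_multiset_nth_le)
qed

text \<open>
  Orthogonality of the eigenvectors ensures that two entries of the eigenvalue list are found even
  if \<open>a = b\<close>: then the common eigenspace has dimension at least \<open>2\<close>.
\<close>

lemma nth_eigenvalue_1_le:
  fixes A :: "real^'n^'n"
  assumes p: "A *v p = a *\<^sub>R p" "p \<noteq> 0" and x: "A *v x = b *\<^sub>R x" "x \<noteq> 0"
    and orth: "p \<bullet> x = 0" and "a \<le> b"
  shows "nth_eigenvalue A 1 \<le> b"
proof -
  have spec: "a \<in> spectrum A" "b \<in> spectrum A"
    using p x by (auto simp: spectrum_def)
  have "{#a, b#} \<subseteq># eigenvalue_mset A"
  proof (cases "a = b")
    case True
    have "p \<noteq> x" using orth p by auto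
    moreover have "independent {p, x}"
      using p x orth by (intro pairwise_orthogonal_independent)
        (auto simp: pairwise_def orthogonal_def inner_commute)
    ultimately have "2 \<le> count (eigenvalue_mset A) b"
      using independent_card_le_dim[of "{p, x}" "eigenspace A b"] p x True spec
      by (simp add: count_eigenvalue_mset eigenspace_def)
    then show ?thesis using True
      by (auto simp: subseteq_mset_def)
  next
    case False
    have "1 \<le> count (eigenvalue_mset A) a" "1 \<le> count (eigenvalue_mset A) b"
      using independent_card_le_dim[of "{p}" "eigenspace A a"]
        independent_card_le_dim[of "{x}" "eigenspace A b"] p x spec
      by (simp_all add: count_eigenvalue_mset eigenspace_def)
    then show ?thesis using False
      by (auto simp: subseteq_mset_def)
  qed
  then have "filter_mset (\<lambda>c. c \<le> b) {#a, b#} \<subseteq># filter_mset (\<lambda>c. c \<le> b) (eigenvalue_mset A)"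
    by (rule multiset_filter_mono)
  then have "1 < size (filter_mset (\<lambda>c. c \<le> b) (eigenvalue_mset A))"
    using \<open>a \<le> b\<close> by (auto dest: size_mset_mono)
  then show ?thesis
    unfolding nth_eigenvalue_def by (rule sorted_list_of_multiset_nth_le)
qed

text \<open>
  By symmetry the complement of \<open>p\<close> is invariant, so the minimum \<open>\<mu>\<close> of the Rayleigh quotient over it
  is an eigenvalue with an eigenvector orthogonal to \<open>p\<close>. Hence \<open>\<mu>\<close> lies above both of the two lowest
  eigenvalues: the second gives the estimate of the gap, the lowest the nonnegativity of the form.
\<close>

lemma spectral_gap_le_form:
  fixes A :: "real^'n^'n"
  assumes sym: "transpose A = A"
    and p: "A *v p = nth_eigenvalue A 0 *\<^sub>R p" "p \<noteq> 0"
    and z: "p \<bullet> z = 0" "z \<noteq> 0"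
  shows "spectral_gap A * (z \<bullet> z) \<le> z \<bullet> (A *v z) - nth_eigenvalue A 0 * (z \<bullet> z)"
    and "0 \<le> z \<bullet> (A *v z) - nth_eigenvalue A 0 * (z \<bullet> z)"
proof -
  have inv: "A *v y \<in> {y. p \<bullet> y = 0}" if "y \<in> {y. p \<bullet> y = 0}" for y
    using that symmetric_matrix_inner_commute[OF sym, of p y] by (simp add: p)
  obtain x \<mu> where x: "p \<bullet> x = 0" "x \<noteq> 0" "A *v x = \<mu> *\<^sub>R x"
    and ray: "\<And>y. p \<bullet> y = 0 \<Longrightarrow> \<mu> * (y \<bullet> y) \<le> y \<bullet> (A *v y)"
    using symmetric_matrix_minimizer_is_eigenvector[OF sym subspace_hyperplane inv, of z] z
    by auto
  have le0: "nth_eigenvalue A 0 \<le> \<mu>"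
    using nth_eigenvalue_0_le x by blast
  then have "nth_eigenvalue A 1 \<le> \<mu>"
    using nth_eigenvalue_1_le p x by blast
  then have "spectral_gap A * (z \<bullet> z) \<le> (\<mu> - nth_eigenvalue A 0) * (z \<bullet> z)"
    by (intro mult_right_mono) (auto simp: spectral_gap_def)
  also have le: "\<dots> \<le> z \<bullet> (A *v z) - nth_eigenvalue A 0 * (z \<bullet> z)"
    using ray[OF z(1)] by (simp add: algebra_simps)
  finally show "spectral_gap A * (z \<bullet> z) \<le> z \<bullet> (A *v z) - nth_eigenvalue A 0 * (z \<bullet> z)" .
  have "0 \<le> (\<mu> - nth_eigenvalue A 0) * (z \<bullet> z)" using le0 by simp
  with le show "0 \<le> z \<bullet> (A *v z) - nth_eigenvalue A 0 * (z \<bullet> z)" by linarith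
qed

section \<open>Laplacians and the ground-state transform\<close>

text \<open>
  For positive \<open>qweight\<close>, an isometry from functions with the \<open>qweight\<close>-weighted inner product onto vectors with the
  standard one. It lets both kinds of Laplacian be treated at once.
\<close>

definition sqrt_weighted ::
    "laplacian_kind \<Rightarrow> ('v::finite \<Rightarrow> 'v \<Rightarrow> real) \<Rightarrow> ('v \<Rightarrow> real) \<Rightarrow> real^'v" where
  "sqrt_weighted K w g = (\<chi> u. sqrt (qweight K w u) * g u)"

lemma qweight_pos:
  assumes "K = Normalized \<Longrightarrow> \<forall>u. wdegree w u > 0"
  shows "qweight K w u > 0"
  using assms by (cases K) (auto simp: qweight_def)

lemma transpose_laplacian_plus_diagonal:
  assumes "connected_weighted_graph E w" "diagonal_mat W"
  shows "transpose (laplacian K w + W) = laplacian K w + W"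
proof -
  have "W $ j $ i = W $ i $ j" for i j
    using assms(2) by (cases "i = j") (auto simp: diagonal_mat_def)
  moreover have "w i j = w j i" for i j
    using assms(1) by (simp add: connected_weighted_graph_def)
  ultimately show ?thesis
    by (cases K) (auto simp: transpose_def laplacian_def vec_eq_iff mult.commute)
qed

text \<open>
  Conjugating by \<open>sqrt q\<close> cancels the normalization, so that either Laplacian turns into the
  difference operator in the definition of \<open>ground_state\<close>.
\<close>

lemma sqrt_qweight_mult_schroedinger:
  assumes "connected_weighted_graph E w" "\<And>u. 0 < qweight K w u" "diagonal_mat W"
  shows "sqrt (qweight K w u) * ((laplacian K w + W) *v sqrt_weighted K w g) $ u
    = (\<Sum>v\<in>UNIV. w u v * (g u - g v)) + W $ u $ u * qweight K w u * g u"
proof -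
  let ?s = "\<lambda>u. sqrt (qweight K w u)"
  have loop: "w u u = 0" for u
    using assms(1) by (force simp: connected_weighted_graph_def)
  have s: "?s u > 0" "?s u * ?s u = qweight K w u" for u
    using assms(2)[of u] by auto
  have sL: "?s u * laplacian K w $ u $ v * ?s v = (if u = v then wdegree w u else - w u v)" for v
    using s[of u] s[of v] by (cases K) (auto simp: laplacian_def qweight_def real_sqrt_mult field_simps)
  have sW: "?s u * W $ u $ v * ?s v = (if u = v then W $ u $ u * qweight K w u else 0)" for v
    using assms(3) s(2)[of u] by (auto simp: diagonal_mat_def mult_ac)
  have "?s u * ((laplacian K w + W) *v sqrt_weighted K w g) $ u
      = (\<Sum>v\<in>UNIV. (?s u * laplacian K w $ u $ v * ?s v + ?s u * W $ u $ v * ?s v) * g v)"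
    by (simp add: matrix_vector_mult_def sqrt_weighted_def sum_distrib_left algebra_simps)
  also have "\<dots> = (\<Sum>v\<in>UNIV. (if v = u then (wdegree w u + W $ u $ u * qweight K w u) * g u else 0) - w u v * g v)"
    by (intro sum.cong refl) (auto simp: sL sW loop)
  also have "\<dots> = (\<Sum>v\<in>UNIV. w u v * (g u - g v)) + W $ u $ u * qweight K w u * g u"
    by (simp add: sum_subtractf wdegree_def sum_distrib_right right_diff_distrib distrib_right)
  finally show ?thesis .
qed

lemma inner_sqrt_weighted:
  assumes "\<And>u. 0 < qweight K w u"
  shows "sqrt_weighted K w f \<bullet> sqrt_weighted K w g = (\<Sum>u\<in>UNIV. qweight K w u * (f u * g u))"
proof -
  have "sqrt (qweight K w u) * sqrt (qweight K w u) = qweight K w u" for u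
    using assms[of u] by simp
  then have "sqrt (qweight K w u) * f u * (sqrt (qweight K w u) * g u) = qweight K w u * (f u * g u)" for u
    by (metis mult.assoc mult.left_commute)
  then show ?thesis
    by (simp only: inner_vec_def sqrt_weighted_def vec_lambda_beta inner_real_def)
qed

lemma sqrt_weighted_ground_state:
  assumes "connected_weighted_graph E w" "\<And>u. 0 < qweight K w u" "diagonal_mat W"
    and "ground_state K w W \<phi>"
  defines "H \<equiv> laplacian K w + W"
  defines "p \<equiv> sqrt_weighted K w (($) \<phi>)"
  shows "H *v p = nth_eigenvalue H 0 *\<^sub>R p" and "p \<noteq> 0"
proof -
  note q = assms(2)
  have "sqrt (qweight K w u) * (H *v p) $ u
      = sqrt (qweight K w u) * (nth_eigenvalue H 0 *\<^sub>R p) $ u" for u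
  proof -
    have "sqrt (qweight K w u) * (H *v p) $ u
        = (\<Sum>v\<in>UNIV. w u v * (\<phi> $ u - \<phi> $ v)) + W $ u $ u * qweight K w u * \<phi> $ u"
      unfolding H_def p_def by (rule sqrt_qweight_mult_schroedinger[OF assms(1-3)])
    also have "\<dots> = nth_eigenvalue H 0 * qweight K w u * \<phi> $ u"
      using assms(4) unfolding ground_state_def H_def
      by (metis (no_types, lifting) diff_add_cancel distrib_right)
    also have "\<dots> = nth_eigenvalue H 0 * (sqrt (qweight K w u) * sqrt (qweight K w u)) * \<phi> $ u"
      using q[of u] by simp
    also have "\<dots> = sqrt (qweight K w u) * (nth_eigenvalue H 0 *\<^sub>R p) $ u"
      by (simp only: p_def sqrt_weighted_def vector_scaleR_component vec_lambda_beta real_scaleR_def mult_ac)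
    finally show ?thesis .
  qed
  then show "H *v p = nth_eigenvalue H 0 *\<^sub>R p"
    unfolding vec_eq_iff by (metis q mult_left_cancel less_numeral_extra(3) real_sqrt_gt_0_iff)
  show "p \<noteq> 0"
  proof
    assume "p = 0"
    then have "sqrt (qweight K w u) * \<phi> $ u = 0" for u
      by (simp add: p_def sqrt_weighted_def vec_eq_iff)
    then have "\<phi> $ u = 0" for u
      using q[of u] by (metis less_irrefl mult_eq_0_iff real_sqrt_eq_zero_cancel_iff)
    then show False using assms(4) by (simp add: ground_state_def vec_eq_iff)
  qed
qed

text \<open>
  Multiplying the ground-state equation at \<open>u\<close> by \<open>(f u)\<^sup>2 * \<phi> u\<close> gives an expression for the terms in
  \<open>W\<close> and in the lowest eigenvalue; after subtracting it, the terms \<open>(f u * \<phi> u)\<^sup>2\<close> cancel and only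
  products \<open>\<phi> u * \<phi> v\<close> remain. For symmetric \<open>w\<close> the right-hand side is the usual Dirichlet form, half
  the sum of \<open>w u v * \<phi> u * \<phi> v * (f u - f v)\<^sup>2\<close>; the unsymmetrized version suffices for
  evaluating it on a cut.
\<close>

lemma ground_state_transform:
  fixes f :: "'v::finite \<Rightarrow> real"
  assumes "connected_weighted_graph E w" "\<And>u. 0 < qweight K w u" "diagonal_mat W"
    and "ground_state K w W \<phi>"
  defines "H \<equiv> laplacian K w + W"
  defines "x \<equiv> sqrt_weighted K w (\<lambda>u. f u * \<phi> $ u)"
  shows "x \<bullet> (H *v x) - nth_eigenvalue H 0 * (x \<bullet> x)
    = (\<Sum>u\<in>UNIV. \<Sum>v\<in>UNIV. w u v * \<phi> $ u * \<phi> $ v * (f u * (f u - f v)))"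
proof -
  let ?l = "nth_eigenvalue H 0" and ?q = "qweight K w"
  have pt: "f u * \<phi> $ u * ((\<Sum>v\<in>UNIV. w u v * (f u * \<phi> $ u - f v * \<phi> $ v)) + W $ u $ u * ?q u * (f u * \<phi> $ u))
      - ?l * (?q u * (f u * \<phi> $ u * (f u * \<phi> $ u)))
      = (\<Sum>v\<in>UNIV. w u v * \<phi> $ u * \<phi> $ v * (f u * (f u - f v)))" for u
  proof -
    have "f u * \<phi> $ u * ((\<Sum>v\<in>UNIV. w u v * (f u * \<phi> $ u - f v * \<phi> $ v)) + W $ u $ u * ?q u * (f u * \<phi> $ u))
        - ?l * (?q u * (f u * \<phi> $ u * (f u * \<phi> $ u)))
      = f u * \<phi> $ u * (\<Sum>v\<in>UNIV. w u v * (f u * \<phi> $ u - f v * \<phi> $ v))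
        - f u * f u * \<phi> $ u * ((?l - W $ u $ u) * ?q u * \<phi> $ u)"
      by (simp add: algebra_simps)
    also have "(?l - W $ u $ u) * ?q u * \<phi> $ u = (\<Sum>v\<in>UNIV. w u v * (\<phi> $ u - \<phi> $ v))"
      using assms(4) by (simp add: ground_state_def H_def)
    also have "f u * \<phi> $ u * (\<Sum>v\<in>UNIV. w u v * (f u * \<phi> $ u - f v * \<phi> $ v))
        - f u * f u * \<phi> $ u * (\<Sum>v\<in>UNIV. w u v * (\<phi> $ u - \<phi> $ v))
        = (\<Sum>v\<in>UNIV. w u v * \<phi> $ u * \<phi> $ v * (f u * (f u - f v)))"
      unfolding sum_distrib_left sum_subtractf[symmetric]
      by (intro sum.cong refl) (simp add: algebra_simps)
    finally show ?thesis .
  qed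
  have "x \<bullet> (H *v x) = (\<Sum>u\<in>UNIV. f u * \<phi> $ u * (sqrt (?q u) * (H *v x) $ u))"
    by (auto simp: inner_vec_def x_def sqrt_weighted_def mult_ac intro!: sum.cong)
  also have "\<dots> = (\<Sum>u\<in>UNIV. f u * \<phi> $ u *
      ((\<Sum>v\<in>UNIV. w u v * (f u * \<phi> $ u - f v * \<phi> $ v)) + W $ u $ u * ?q u * (f u * \<phi> $ u)))"
    unfolding x_def H_def by (simp only: sqrt_qweight_mult_schroedinger[OF assms(1-3)])
  finally have xHx: "x \<bullet> (H *v x) = \<dots>" .
  have xx: "x \<bullet> x = (\<Sum>u\<in>UNIV. ?q u * (f u * \<phi> $ u * (f u * \<phi> $ u)))"
    unfolding x_def by (rule inner_sqrt_weighted[OF assms(2)])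
  show ?thesis
    unfolding xHx xx sum_distrib_left sum_subtractf[symmetric] by (simp only: pt)
qed

section \<open>The cut test function and the Cheeger bound\<close>

lemma sum_split_Compl:
  fixes f :: "'v::finite \<Rightarrow> real"
  shows "(\<Sum>u\<in>UNIV. f u) = (\<Sum>u\<in>S. f u) + (\<Sum>u\<in>- S. f u)"
  by (metis Compl_partition Compl_disjoint finite sum.union_disjoint)

text \<open>
  A pair on one side of the cut contributes nothing. A pair across the cut contributes
  its weight times \<open>b * (a + b)\<close> if its first vertex lies in \<open>S\<close> and times \<open>a * (a + b)\<close> otherwise; these factors add up to
  \<open>(a + b)\<^sup>2\<close> for the two orientations of an edge.
\<close>

lemma two_valued_form_eq_boundary_weight:
  fixes w :: "'v::finite \<Rightarrow> 'v \<Rightarrow> real" and a b :: real and S :: "'v set"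
  assumes "\<And>u v. w u v = w v u"
  defines "f \<equiv> \<lambda>u. if u \<in> S then b else - a"
  shows "(\<Sum>u\<in>UNIV. \<Sum>v\<in>UNIV. w u v * \<phi> $ u * \<phi> $ v * (f u * (f u - f v)))
    = (a + b)\<^sup>2 * boundary_weight w \<phi> S"
proof -
  have 1: "(\<Sum>v\<in>UNIV. w u v * \<phi> $ u * \<phi> $ v * (f u * (f u - f v)))
      = b * (a + b) * (\<Sum>v\<in>- S. w u v * \<phi> $ u * \<phi> $ v)" if "u \<in> S" for u
    unfolding sum_split_Compl[of _ S] using that
    by (simp add: f_def sum_distrib_left mult_ac add.commute)
  have 2: "(\<Sum>v\<in>UNIV. w u v * \<phi> $ u * \<phi> $ v * (f u * (f u - f v)))
      = a * (a + b) * (\<Sum>v\<in>S. w v u * \<phi> $ v * \<phi> $ u)" if "u \<in> - S" for u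
  proof -
    have "f u * (f u - f v) = a * (a + b)" if "v \<in> S" for v
      using that \<open>u \<in> - S\<close> by (simp add: f_def algebra_simps)
    moreover have "f u - f v = 0" if "v \<in> - S" for v
      using that \<open>u \<in> - S\<close> by (simp add: f_def)
    ultimately show ?thesis
      unfolding sum_split_Compl[of _ S] using assms(1)[of u]
      by (simp add: sum_distrib_left mult_ac)
  qed
  have "(\<Sum>u\<in>UNIV. \<Sum>v\<in>UNIV. w u v * \<phi> $ u * \<phi> $ v * (f u * (f u - f v)))
      = b * (a + b) * boundary_weight w \<phi> S
        + a * (a + b) * (\<Sum>u\<in>- S. \<Sum>v\<in>S. w v u * \<phi> $ v * \<phi> $ u)"
    by (subst sum_split_Compl[of _ S]) (simp add: 1 2 boundary_weight_def sum_distrib_left)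
  also have "(\<Sum>u\<in>- S. \<Sum>v\<in>S. w v u * \<phi> $ v * \<phi> $ u) = boundary_weight w \<phi> S"
    unfolding boundary_weight_def by (rule sum.swap)
  finally show ?thesis by (simp add: power2_eq_square algebra_simps)
qed

lemma spectral_gap_le_twice_cheeger_ratio:
  assumes "connected_weighted_graph E w" "\<And>u. 0 < qweight K w u" "diagonal_mat W"
    and "ground_state K w W \<phi>" and S: "S \<in> admissible_cuts K w \<phi>"
  shows "spectral_gap (laplacian K w + W) \<le> 2 * cheeger_ratio K w \<phi> S"
proof -
  define H where "H = laplacian K w + W"
  define a where "a = vol K w \<phi> S"
  define b where "b = vol K w \<phi> (- S)"
  define d where "d = boundary_weight w \<phi> S"
  have ab: "a > 0" "b > 0" using S by (auto simp: admissible_cuts_def a_def b_def)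
  \<comment> \<open>A multiple of \<open>1 / a\<close> on \<open>S\<close> and \<open>- 1 / b\<close> off \<open>S\<close>; these values are, up to scaling, the only
     ones whose weighted mean vanishes, which makes \<open>x\<close> below orthogonal to \<open>p\<close>.\<close>
  define f where "f = (\<lambda>u. if u \<in> S then b else - a)"
  define p where "p = sqrt_weighted K w (($) \<phi>)"
  define x where "x = sqrt_weighted K w (\<lambda>u. f u * \<phi> $ u)"
  have p: "H *v p = nth_eigenvalue H 0 *\<^sub>R p" "p \<noteq> 0"
    unfolding H_def p_def using sqrt_weighted_ground_state[OF assms(1-4)] by auto
  have "p \<bullet> x = (\<Sum>u\<in>UNIV. f u * (qweight K w u * (\<phi> $ u)\<^sup>2))"
    unfolding p_def x_def inner_sqrt_weighted[OF assms(2)]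
    by (simp add: power2_eq_square mult_ac)
  also have "\<dots> = b * a + (- a) * b"
    by (subst sum_split_Compl[of _ S]) (simp add: a_def b_def vol_def f_def sum_distrib_left sum_negf)
  finally have orth: "p \<bullet> x = 0" by simp
  have "x \<bullet> x = (\<Sum>u\<in>UNIV. (f u)\<^sup>2 * (qweight K w u * (\<phi> $ u)\<^sup>2))"
    unfolding x_def inner_sqrt_weighted[OF assms(2)]
    by (simp add: power2_eq_square mult_ac)
  also have "\<dots> = b\<^sup>2 * a + a\<^sup>2 * b"
    by (subst sum_split_Compl[of _ S]) (simp add: a_def b_def vol_def f_def sum_distrib_left)
  finally have xx: "x \<bullet> x = a * b * (a + b)" by (simp add: power2_eq_square algebra_simps)
  then have "x \<noteq> 0" using ab by auto
  have form: "x \<bullet> (H *v x) - nth_eigenvalue H 0 * (x \<bullet> x) = (a + b)\<^sup>2 * d"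
    unfolding H_def x_def ground_state_transform[OF assms(1-4)] d_def f_def
    using assms(1) by (intro two_valued_form_eq_boundary_weight) (simp add: connected_weighted_graph_def)
  have sym: "transpose H = H"
    unfolding H_def by (rule transpose_laplacian_plus_diagonal[OF assms(1,3)])
  note gap = spectral_gap_le_form[OF sym p orth \<open>x \<noteq> 0\<close>, unfolded form, unfolded xx]
  \<comment> \<open>The sign of \<open>d\<close> needs the minimality of the lowest eigenvalue, as single weights may be negative.\<close>
  have "0 \<le> d" using gap(2) ab by (simp add: zero_le_mult_iff)
  have "(a + b) * (spectral_gap H * (a * b)) \<le> (a + b) * ((a + b) * d)"
    using gap(1) by (simp add: power2_eq_square mult_ac)
  then have "spectral_gap H * (a * b) \<le> (a + b) * d"
    using ab by simp
  then have "spectral_gap H \<le> d / a + d / b"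
    using ab by (simp add: field_simps)
  also have "\<dots> \<le> d / min a b + d / min a b"
    using ab \<open>0 \<le> d\<close> by (intro add_mono divide_left_mono) auto
  finally show ?thesis
    by (simp add: H_def cheeger_ratio_def a_def b_def d_def)
qed

theorem theorem1:
  fixes E :: "'v::finite set set"
    and w :: "'v \<Rightarrow> 'v \<Rightarrow> real"
    and W :: "real^'v^'v"
    and \<phi> :: "real^'v"
    and K :: laplacian_kind
  assumes "CARD('v) \<ge> 2"
    and "connected_weighted_graph E w"
    and "K = Normalized \<Longrightarrow> \<forall>u. wdegree w u > 0"
    and "diagonal_mat W"
    and "ground_state K w W \<phi>"
    and "\<forall>u. \<phi> $ u \<ge> 0"
  shows "ereal (spectral_gap (laplacian K w + W)) \<le> 2 * cheeger_constant K w \<phi>"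
proof (cases "admissible_cuts K w \<phi> = {}")
  case True
  \<comment> \<open>Without admissible cuts the Cheeger constant is \<open>\<infinity>\<close>.\<close>
  then show ?thesis by (simp add: cheeger_constant_def top_ereal_def)
next
  case False
  then have "Min (cheeger_ratio K w \<phi> ` admissible_cuts K w \<phi>) \<in> cheeger_ratio K w \<phi> ` admissible_cuts K w \<phi>"
    by (intro Min_in) auto
  then obtain S where "S \<in> admissible_cuts K w \<phi>" "cheeger_constant K w \<phi> = ereal (cheeger_ratio K w \<phi> S)"
    using cheeger_constant_eq_Min[OF False] by auto
  then show ?thesis
    using spectral_gap_le_twice_cheeger_ratio[OF assms(2) qweight_pos[of K w] assms(4,5)] assms(3) by simp
qed

end
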